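(* Let $a,b,c,d,m,n\in\mathbb{Z}$. Suppose that $(a-1,b)$, $(c,d-1)$ and $(m,n)$ belong to a cyclic subgroup of $\mathbb{Z}^2$ generated by an element of the form $(0,q)$, $(1,q)$, $(p,0)$ or $(p,1)$, where $p,q\in\mathbb{Z}$, and let $r,s\in\mathbb{Z}$. Then there exist $w\in\mathbb{F}_2(u,v)$, a split fixed point free $2$-valued map $\phi\colon\mathbb{T}^2\multimap\mathbb{T}^2$ and a lift $\widehat\Phi\colon\mathbb{T}^2\to F_2(\mathbb{T}^2)$ of $\phi$ such that $\mathrm{Ab}(w)=(m,n)$, $\widehat\Phi_{\#}(e_1)=(w^r,(a,b))$ and $\widehat\Phi_{\#}(e_2)=(w^s,(c,d))$.
   Context: A $2$-valued map $\phi\colon X\multimap Y$ assigns to each $x\in X$ a subset $\phi(x)\subset Y$ of exactly two points, and is continuous: for every open $V\subset Y$ the sets $\{x\mid\phi(x)\subset V\}$ and $\{x\mid\phi(x)\cap V\neq\varnothing\}$ are open and each $\phi(x)$ is closed. It is split if $\phi(x)=\{f_1(x),f_2(x)\}$ for continuous maps $f_1,f_2\colon X\to Y$. $\phi\colon X\multimap X$ is fixed point free if $x\notin\phi(x)$ for all $x$. $F_2(\mathbb{T}^2)=\{(y_1,y_2)\in\mathbb{T}^2\times\mathbb{T}^2\mid y_1\neq y_2\}$; a lift of a split map $\phi=\{f_1,f_2\}$ is a map $\widehat\Phi=(f_1,f_2)\colon\mathbb{T}^2\to F_2(\mathbb{T}^2)$. $(e_1,e_2)$ is the basis of $\pi_1(\mathbb{T}^2)\cong\mathbb{Z}^2$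 given by the meridian and longitude. $P_2(\mathbb{T}^2)=\pi_1(F_2(\mathbb{T}^2))$ is identified with $\mathbb{F}_2(u,v)\times\mathbb{Z}^2$ as follows. Let $p_i\colon F_2(\mathbb{T}^2)\to\mathbb{T}^2$ be the $i$-th projection. $\mathbb{F}_2(u,v)$ is the kernel of $p_{2\#}$, i.e. $\pi_1(\mathbb{T}^2\setminus\{x_2\},x_1)$, which is free on $u,v$, where $p_{1\#}(u)=e_1$, $p_{1\#}(v)=e_2$; the factor $\mathbb{Z}^2$ is the centre of $P_2(\mathbb{T}^2)$, with basis $x,y$ satisfying $p_{i\#}(x)=e_1$, $p_{i\#}(y)=e_2$ for $i=1,2$ (both points moving together along the meridian, resp. the longitude). The element $wx^ay^b$ is written $(w,(a,b))$. $\mathrm{Ab}\colon\mathbb{F}_2(u,v)\to\mathbb{Z}^2$ is Abelianisation, $u\mapsto(1,0)$, $v\mapsto(0,1)$. Basepoints are suppressed (fundamental groups at different basepoints being identified via paths). *)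

theory Defs
  imports "HOL-Analysis.Analysis" "HOL-Algebra.Elementary_Groups"
begin

definition path_class :: "'a::topological_space set \<Rightarrow> (real \<Rightarrow> 'a) \<Rightarrow> (real \<Rightarrow> 'a) set" where
  "path_class S p = {q. homotopic_paths S p q}"

definition pi1 :: "'a::real_normed_vector set \<Rightarrow> 'a \<Rightarrow> (real \<Rightarrow> 'a) set monoid" where
  "pi1 S x =
    \<lparr>carrier = path_class S ` {p. path p \<and> path_image p \<subseteq> S \<and> pathstart p = x \<and> pathfinish p = x},
     mult = (\<lambda>A B. {r. \<exists>p\<in>A. \<exists>q\<in>B. homotopic_paths S (p +++ q) r}),
     one = path_class S (linepath x x)\<rparr>"

definition pi1_map :: "'b::topological_space set \<Rightarrow> ('a \<Rightarrow> 'b) \<Rightarrow> (real \<Rightarrow> 'a) set \<Rightarrow> (real \<Rightarrow> 'b) set" where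
  "pi1_map T f A = {q. \<exists>p\<in>A. homotopic_paths T (f \<circ> p) q}"

text \<open>For a path \<open>g\<close> in \<open>S\<close> from \<open>x\<close> to \<open>y\<close>, the isomorphism from \<open>pi1 S y\<close> to \<open>pi1 S x\<close>.\<close>

definition pi1_transport :: "'a::topological_space set \<Rightarrow> (real \<Rightarrow> 'a) \<Rightarrow> (real \<Rightarrow> 'a) set \<Rightarrow> (real \<Rightarrow> 'a) set" where
  "pi1_transport S g A = {q. \<exists>p\<in>A. homotopic_paths S (g +++ (p +++ reversepath g)) q}"

text \<open>The letter \<open>(x, True)\<close> stands for \<open>x\<close> and \<open>(x, False)\<close> for its inverse.\<close>

definition reduced_word :: "('a \<times> bool) list \<Rightarrow> bool" where
  "reduced_word ws = successively (\<lambda>(x, e) (y, f). \<not> (x = y \<and> e \<noteq> f)) ws"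

definition word_value :: "('a, 'b) monoid_scheme \<Rightarrow> ('a \<times> bool) list \<Rightarrow> 'a" where
  "word_value G ws = foldr (\<lambda>(x, e) g. (if e then x else inv\<^bsub>G\<^esub> x) \<otimes>\<^bsub>G\<^esub> g) ws \<one>\<^bsub>G\<^esub>"

definition free_basis :: "('a, 'b) monoid_scheme \<Rightarrow> 'a set \<Rightarrow> bool" where
  "free_basis G S \<longleftrightarrow> S \<subseteq> carrier G \<and>
     bij_betw (word_value G) {ws \<in> lists (S \<times> UNIV). reduced_word ws} (carrier G)"

type_synonym pt = "complex \<times> complex"

definition torus :: "pt set" where
  "torus = sphere 0 1 \<times> sphere 0 1"

definition meridian :: "pt \<Rightarrow> real \<Rightarrow> pt" where
  "meridian z t = (fst z * cis (2 * pi * t), snd z)"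

definition longitude :: "pt \<Rightarrow> real \<Rightarrow> pt" where
  "longitude z t = (fst z, snd z * cis (2 * pi * t))"

definition e1 :: "pt \<Rightarrow> (real \<Rightarrow> pt) set" where
  "e1 z = path_class torus (meridian z)"

definition e2 :: "pt \<Rightarrow> (real \<Rightarrow> pt) set" where
  "e2 z = path_class torus (longitude z)"

definition config2 :: "'a set \<Rightarrow> ('a \<times> 'a) set" where
  "config2 X = {(y1, y2) \<in> X \<times> X. y1 \<noteq> y2}"

definition P2 :: "pt \<times> pt \<Rightarrow> (real \<Rightarrow> pt \<times> pt) set monoid" where
  "P2 xx = pi1 (config2 torus) xx"

text \<open>Via \<open>y \<mapsto> (y, snd xx)\<close> this kernel is the fundamental group of
  \<open>torus - {snd xx}\<close> at \<open>fst xx\<close>, which is free of rank two.\<close>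

definition fibre_group :: "pt \<times> pt \<Rightarrow> (real \<Rightarrow> pt \<times> pt) set monoid" where
  "fibre_group xx = (P2 xx)
     \<lparr>carrier := kernel (P2 xx) (pi1 torus (snd xx)) (pi1_map torus snd)\<rparr>"

text \<open>Translating both points together gives central elements; \<open>central_x xx\<close> and
  \<open>central_y xx\<close> form a basis of the centre of \<open>P2 xx\<close>.\<close>

definition central_x :: "pt \<times> pt \<Rightarrow> (real \<Rightarrow> pt \<times> pt) set" where
  "central_x xx = path_class (config2 torus) (\<lambda>t. (meridian (fst xx) t, meridian (snd xx) t))"

definition central_y :: "pt \<times> pt \<Rightarrow> (real \<Rightarrow> pt \<times> pt) set" where
  "central_y xx = path_class (config2 torus) (\<lambda>t. (longitude (fst xx) t, longitude (snd xx) t))"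

text \<open>The element written \<open>(w, (a, b))\<close> in the product decomposition of \<open>P2 xx\<close>.\<close>

definition P2_elem ::
  "pt \<times> pt \<Rightarrow> (real \<Rightarrow> pt \<times> pt) set \<Rightarrow> int \<times> int \<Rightarrow> (real \<Rightarrow> pt \<times> pt) set" where
  "P2_elem xx w ab =
     w \<otimes>\<^bsub>P2 xx\<^esub> (central_x xx [^]\<^bsub>P2 xx\<^esub> fst ab) \<otimes>\<^bsub>P2 xx\<^esub> (central_y xx [^]\<^bsub>P2 xx\<^esub> snd ab)"

abbreviation Z2 :: "(int \<times> int) monoid" where
  "Z2 \<equiv> integer_group \<times>\<times> integer_group"

definition multimap_continuous ::
  "'a::topological_space set \<Rightarrow> 'b::topological_space set \<Rightarrow> ('a \<Rightarrow> 'b set) \<Rightarrow> bool" where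
  "multimap_continuous X Y \<phi> \<longleftrightarrow>
     (\<forall>x\<in>X. closedin (top_of_set Y) (\<phi> x)) \<and>
     (\<forall>V. openin (top_of_set Y) V \<longrightarrow>
        openin (top_of_set X) {x \<in> X. \<phi> x \<subseteq> V} \<and>
        openin (top_of_set X) {x \<in> X. \<phi> x \<inter> V \<noteq> {}})"

definition two_valued_map ::
  "'a::topological_space set \<Rightarrow> 'b::topological_space set \<Rightarrow> ('a \<Rightarrow> 'b set) \<Rightarrow> bool" where
  "two_valued_map X Y \<phi> \<longleftrightarrow>
     (\<forall>x\<in>X. \<phi> x \<subseteq> Y \<and> card (\<phi> x) = 2) \<and> multimap_continuous X Y \<phi>"

definition split_map ::
  "'a::topological_space set \<Rightarrow> 'b::topological_space set \<Rightarrow> ('a \<Rightarrow> 'b set) \<Rightarrow> bool" where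
  "split_map X Y \<phi> \<longleftrightarrow>
     (\<exists>f1 f2. continuous_on X f1 \<and> f1 ` X \<subseteq> Y \<and> continuous_on X f2 \<and> f2 ` X \<subseteq> Y \<and>
        (\<forall>x\<in>X. \<phi> x = {f1 x, f2 x}))"

definition fixed_point_free :: "'a set \<Rightarrow> ('a \<Rightarrow> 'a set) \<Rightarrow> bool" where
  "fixed_point_free X \<phi> \<longleftrightarrow> (\<forall>x\<in>X. x \<notin> \<phi> x)"

definition is_lift ::
  "'a::topological_space set \<Rightarrow> 'b::topological_space set \<Rightarrow> ('a \<Rightarrow> 'b set) \<Rightarrow> ('a \<Rightarrow> 'b \<times> 'b) \<Rightarrow> bool" where
  "is_lift X Y \<phi> \<Phi> \<longleftrightarrow>
     continuous_on X \<Phi> \<and> \<Phi> ` X \<subseteq> config2 Y \<and> (\<forall>x\<in>X. \<phi> x = {fst (\<Phi> x), snd (\<Phi> x)})"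

text \<open>Identifications of the fundamental groups of \<open>S\<close> at all basepoints with the one at \<open>x\<close>:
  a choice, for every \<open>y\<close> in \<open>S\<close>, of a path in \<open>S\<close> from \<open>x\<close> to \<open>y\<close>.\<close>

definition basepoint_paths :: "'a::topological_space set \<Rightarrow> 'a \<Rightarrow> ('a \<Rightarrow> real \<Rightarrow> 'a) \<Rightarrow> bool" where
  "basepoint_paths S x g \<longleftrightarrow>
     (\<forall>y\<in>S. path (g y) \<and> path_image (g y) \<subseteq> S \<and> pathstart (g y) = x \<and> pathfinish (g y) = y)"

end

theory Submission
  imports Defs "HOL-Complex_Analysis.Winding_Numbers" "HOL-Library.Real_Mod"
begin

text \<open>
  The torus is a group, so maps can be written down explicitly. Let \<open>g\<close> generate the cyclic subgroup
  and let \<open>H\<close> be the image in the torus of the real line spanned by \<open>g\<close>. Let \<open>f2\<close> be an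
  affine map (a group endomorphism followed by a translation) whose linear part has columns
  \<open>(a, b)\<close> and \<open>(c, d)\<close>, and let \<open>f1\<close> be an affine map whose linear part has columns
  \<open>(a, b) + r (m, n)\<close> and \<open>(c, d) + s (m, n)\<close>. As \<open>(a - 1, b)\<close>, \<open>(c, d - 1)\<close> and \<open>(m, n)\<close> are multiples of
  \<open>g\<close>, the quotients \<open>f2 x / x\<close>, \<open>f1 x / f2 x\<close> and \<open>f1 x / x\<close> each stay in a single
  coset of \<open>H\<close>. Taking \<open>\<epsilon>\<close> and \<open>\<epsilon> ^ 2\<close> as the translation parts of \<open>f2\<close> and \<open>f1\<close>, the cosets are those of \<open>\<epsilon>\<close>, \<open>\<epsilon>\<close> and \<open>\<epsilon> ^ 2\<close>. If
  neither \<open>\<epsilon>\<close> nor \<open>\<epsilon> ^ 2\<close> lies in \<open>H\<close>, then \<open>{f1, f2}\<close> is a fixed point free two-valued map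
  (\<open>line_avoiding_lattice\<close>, \<open>torus_affine_no_coincidence\<close>).

  The induced homomorphism is read off from a flow with three real parameters on pairs of points
  (\<open>pair_flow\<close>): one parameter moves the first point along \<open>(m, n)\<close>, the other two translate both
  points together. On the pair \<open>(f1 z, f2 z)\<close> the flow never makes the points collide, and integer
  parameters act trivially. Hence each integer triple gives a loop, and the class of the loop depends
  additively on the triple (\<open>periodic_loop_add\<close>). The images of meridian and longitude under
  \<open>(f1, f2)\<close> are the loops of \<open>(r, a, b)\<close> and \<open>(s, c, d)\<close>. After transport to the given
  base point, the loops of \<open>(0, 1, 0)\<close> and \<open>(0, 0, 1)\<close> are the two central generators, and the
  class of \<open>(1, 0, 0)\<close> is taken as \<open>w\<close> (\<open>transport_pair_flow\<close>).

  It remains to see that \<open>Ab w = (m, n)\<close>. The first projection, read as a homomorphism into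
  \<open>pi1 torus\<close>, agrees with \<open>Ab\<close> on the free generators, hence everywhere; \<open>w\<close> projects to a loop
  of translations by \<open>(m, n)\<close>; and winding numbers show that such a loop determines \<open>(m, n)\<close>.
\<close>

section \<open>Fundamental groups\<close>

definition loops_at :: "'a::topological_space set \<Rightarrow> 'a \<Rightarrow> (real \<Rightarrow> 'a) set" where
  "loops_at S x = {p. path p \<and> path_image p \<subseteq> S \<and> pathstart p = x \<and> pathfinish p = x}"

lemma loops_atI:
  "\<lbrakk>path p; path_image p \<subseteq> S; pathstart p = x; pathfinish p = x\<rbrakk> \<Longrightarrow> p \<in> loops_at S x"
  by (simp add: loops_at_def)

lemma loops_atD:
  assumes "p \<in> loops_at S x"
  shows "path p" "path_image p \<subseteq> S" "pathstart p = x" "pathfinish p = x"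
  using assms by (simp_all add: loops_at_def)

lemma loops_at_join: "\<lbrakk>p \<in> loops_at S x; q \<in> loops_at S x\<rbrakk> \<Longrightarrow> p +++ q \<in> loops_at S x"
  by (simp add: loops_at_def subset_path_image_join)

lemma loops_at_reversepath: "p \<in> loops_at S x \<Longrightarrow> reversepath p \<in> loops_at S x"
  by (simp add: loops_at_def)

lemma loops_at_const:
  fixes x :: "'a::real_normed_vector"
  shows "x \<in> S \<Longrightarrow> linepath x x \<in> loops_at S x"
  by (simp add: loops_at_def)

lemma loops_at_compose:
  assumes "p \<in> loops_at S x" "continuous_on S f" "f ` S \<subseteq> T"
  shows "f \<circ> p \<in> loops_at T (f x)"
proof (rule loops_atI)
  note p = loops_atD[OF assms(1)]
  show "path (f \<circ> p)"
    using path_continuous_image[OF p(1) continuous_on_subset[OF assms(2) p(2)]] .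
  show "path_image (f \<circ> p) \<subseteq> T"
    using p(2) assms(3) unfolding path_image_compose by blast
qed (use loops_atD[OF assms(1)] in \<open>simp_all add: pathstart_compose pathfinish_compose\<close>)

lemma path_class_eq:
  assumes "homotopic_paths S p q"
  shows "path_class S p = path_class S q"
  unfolding path_class_def
  using assms homotopic_paths_sym homotopic_paths_trans by blast

lemma path_class_eq_iff:
  assumes "path q" "path_image q \<subseteq> S"
  shows "path_class S p = path_class S q \<longleftrightarrow> homotopic_paths S p q"
  using assms path_class_eq[of S p q]
  by (metis homotopic_paths_refl mem_Collect_eq path_class_def)

lemma pi1_carrier: "carrier (pi1 S x) = path_class S ` loops_at S x"
  by (simp add: pi1_def loops_at_def)

lemma pi1_one: "\<one>\<^bsub>pi1 S x\<^esub> = path_class S (linepath x x)"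
  by (simp add: pi1_def)

lemma path_class_in_pi1: "p \<in> loops_at S x \<Longrightarrow> path_class S p \<in> carrier (pi1 S x)"
  by (simp add: pi1_carrier)

lemma pi1_mult:
  assumes p: "p \<in> loops_at S x" and q: "q \<in> loops_at S x"
  shows "path_class S p \<otimes>\<^bsub>pi1 S x\<^esub> path_class S q = path_class S (p +++ q)"
proof -
  have "homotopic_paths S (p +++ q) r"
    if "homotopic_paths S p p'" "homotopic_paths S q q'" "homotopic_paths S (p' +++ q') r"
    for p' q' r
    using that loops_atD[OF p] loops_atD[OF q]
    by (metis homotopic_paths_join homotopic_paths_trans)
  moreover have "homotopic_paths S p p" "homotopic_paths S q q"
    using loops_atD[OF p] loops_atD[OF q] by simp_all
  ultimately have "(\<exists>p'. homotopic_paths S p p' \<and> (\<exists>q'. homotopic_paths S q q' \<and> homotopic_paths S (p' +++ q') r))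
      \<longleftrightarrow> homotopic_paths S (p +++ q) r" for r
    by blast
  then show ?thesis
    by (simp add: pi1_def path_class_def)
qed

lemma group_pi1:
  assumes "x \<in> S"
  shows "group (pi1 S x)"
proof (rule groupI)
  show "\<one>\<^bsub>pi1 S x\<^esub> \<in> carrier (pi1 S x)"
    by (simp add: assms loops_at_const path_class_in_pi1 pi1_one)
next
  fix A B assume "A \<in> carrier (pi1 S x)" "B \<in> carrier (pi1 S x)"
  then show "A \<otimes>\<^bsub>pi1 S x\<^esub> B \<in> carrier (pi1 S x)"
    by (auto simp: pi1_carrier pi1_mult loops_at_join)
next
  fix A B C assume "A \<in> carrier (pi1 S x)" "B \<in> carrier (pi1 S x)" "C \<in> carrier (pi1 S x)"
  then obtain p q r where *: "p \<in> loops_at S x" "q \<in> loops_at S x" "r \<in> loops_at S x"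
    "A = path_class S p" "B = path_class S q" "C = path_class S r"
    by (auto simp: pi1_carrier)
  have "homotopic_paths S (p +++ q +++ r) ((p +++ q) +++ r)"
    using *(1-3)[THEN loops_atD(1)] *(1-3)[THEN loops_atD(2)]
          *(1-3)[THEN loops_atD(3)] *(1-3)[THEN loops_atD(4)]
    by (simp add: homotopic_paths_assoc)
  then show "A \<otimes>\<^bsub>pi1 S x\<^esub> B \<otimes>\<^bsub>pi1 S x\<^esub> C = A \<otimes>\<^bsub>pi1 S x\<^esub> (B \<otimes>\<^bsub>pi1 S x\<^esub> C)"
    using * by (simp add: pi1_mult loops_at_join path_class_eq)
next
  fix A assume "A \<in> carrier (pi1 S x)"
  then obtain p where p: "p \<in> loops_at S x" and A: "A = path_class S p"
    by (auto simp: pi1_carrier)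
  show "\<one>\<^bsub>pi1 S x\<^esub> \<otimes>\<^bsub>pi1 S x\<^esub> A = A"
    using p loops_atD[OF p] homotopic_paths_lid[of p S] assms
    by (simp add: A pi1_one pi1_mult loops_at_const path_class_eq)
  have "path_class S (reversepath p) \<otimes>\<^bsub>pi1 S x\<^esub> A = \<one>\<^bsub>pi1 S x\<^esub>"
    using p loops_atD[OF p] homotopic_paths_linv[of p S]
    by (simp add: A pi1_one pi1_mult loops_at_reversepath path_class_eq)
  then show "\<exists>B\<in>carrier (pi1 S x). B \<otimes>\<^bsub>pi1 S x\<^esub> A = \<one>\<^bsub>pi1 S x\<^esub>"
    using p loops_at_reversepath path_class_in_pi1 by blast
qed

lemma pi1_map_path_class:
  assumes f: "continuous_on S f" "f ` S \<subseteq> T" and p: "p \<in> loops_at S x"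
  shows "pi1_map T f (path_class S p) = path_class T (f \<circ> p)"
proof -
  have "homotopic_paths T (f \<circ> p) (f \<circ> p')" if "homotopic_paths S p p'" for p'
    by (rule homotopic_paths_continuous_image[OF that f(1)]) (use f(2) in auto)
  then have "(\<exists>p'. homotopic_paths S p p' \<and> homotopic_paths T (f \<circ> p') q) \<longleftrightarrow> homotopic_paths T (f \<circ> p) q" for q
    using loops_atD[OF p] by (meson homotopic_paths_refl homotopic_paths_trans)
  then show ?thesis
    by (simp add: pi1_map_def path_class_def)
qed

lemma pi1_map_hom:
  assumes "continuous_on S f" "f ` S \<subseteq> T"
  shows "pi1_map T f \<in> hom (pi1 S x) (pi1 T (f x))"
proof (rule homI)
  fix A B assume "A \<in> carrier (pi1 S x)" "B \<in> carrier (pi1 S x)"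
  then obtain p q where *: "p \<in> loops_at S x" "A = path_class S p" "q \<in> loops_at S x" "B = path_class S q"
    by (auto simp: pi1_carrier)
  then show "pi1_map T f (A \<otimes>\<^bsub>pi1 S x\<^esub> B) = pi1_map T f A \<otimes>\<^bsub>pi1 T (f x)\<^esub> pi1_map T f B"
    using assms
    by (simp add: pi1_mult loops_at_join pi1_map_path_class[where x = x] loops_at_compose path_compose_join)
next
  fix A assume "A \<in> carrier (pi1 S x)"
  then show "pi1_map T f A \<in> carrier (pi1 T (f x))"
    using assms by (auto simp: pi1_carrier pi1_map_path_class loops_at_compose)
qed

lemma loops_at_conjugate:
  assumes "path g" "path_image g \<subseteq> S" "pathstart g = x" "pathfinish g = y" "p \<in> loops_at S y"
  shows "g +++ (p +++ reversepath g) \<in> loops_at S x"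
  using assms by (simp add: loops_at_def subset_path_image_join)

lemma pi1_transport_path_class:
  assumes "path g" "path_image g \<subseteq> S" "pathfinish g = y" "p \<in> loops_at S y"
  shows "pi1_transport S g (path_class S p) = path_class S (g +++ (p +++ reversepath g))"
proof -
  have "homotopic_paths S (g +++ p +++ reversepath g) q"
    if "homotopic_paths S p p'" "homotopic_paths S (g +++ p' +++ reversepath g) q" for p' q
  proof -
    have "homotopic_paths S (g +++ p +++ reversepath g) (g +++ p' +++ reversepath g)"
      using that(1) assms loops_atD[OF assms(4)]
      by (intro homotopic_paths_join) (simp_all add: subset_path_image_join)
    then show ?thesis
      using that(2) homotopic_paths_trans by blast
  qed
  moreover have "homotopic_paths S p p"
    using loops_atD[OF assms(4)] by simp
  ultimately show ?thesis
    unfolding pi1_transport_def path_class_def by blast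
qed

lemma homotopic_paths_join_right:
  assumes "homotopic_paths S q q'" "path p" "path_image p \<subseteq> S" "pathfinish p = pathstart q"
  shows "homotopic_paths S (p +++ q) (p +++ q')"
  using assms by (simp add: homotopic_paths_join)

lemma homotopic_paths_cancel_inverse:
  fixes g q :: "real \<Rightarrow> 'a::real_normed_vector"
  assumes g: "path g" "path_image g \<subseteq> S"
    and q: "path q" "path_image q \<subseteq> S" "pathstart q = pathfinish g"
  shows "homotopic_paths S (reversepath g +++ (g +++ q)) q"
proof -
  let ?c = "linepath (pathfinish g) (pathfinish g)"
  have "homotopic_paths S (reversepath g +++ (g +++ q)) ((reversepath g +++ g) +++ q)"
    using g q by (intro homotopic_paths_assoc) simp_all
  moreover have "homotopic_paths S ((reversepath g +++ g) +++ q) (?c +++ q)"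
    by (rule homotopic_paths_join) (use homotopic_paths_linv[OF g] g q in simp_all)
  moreover have "homotopic_paths S (?c +++ q) q"
    using q homotopic_paths_lid[of q S] by simp
  ultimately show ?thesis
    using homotopic_paths_trans by blast
qed

lemma pi1_transport_hom:
  assumes g: "path g" "path_image g \<subseteq> S" "pathstart g = x" "pathfinish g = y"
  shows "pi1_transport S g \<in> hom (pi1 S y) (pi1 S x)"
proof (rule homI)
  fix A assume "A \<in> carrier (pi1 S y)"
  then show "pi1_transport S g A \<in> carrier (pi1 S x)"
    using g by (auto simp: pi1_carrier pi1_transport_path_class loops_at_conjugate)
next
  fix A B assume "A \<in> carrier (pi1 S y)" "B \<in> carrier (pi1 S y)"
  then obtain p q where *: "p \<in> loops_at S y" "A = path_class S p" "q \<in> loops_at S y" "B = path_class S q"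
    by (auto simp: pi1_carrier)
  note p = loops_atD[OF *(1)] and q = loops_atD[OF *(3)]
  let ?g = "reversepath g"
  note facts = p q g subset_path_image_join
  have 1: "homotopic_paths S (g +++ (p +++ q) +++ ?g) (g +++ p +++ q +++ ?g)"
    by (rule homotopic_paths_join_right, rule homotopic_paths_sym, rule homotopic_paths_assoc)
      (simp_all add: facts)
  \<comment> \<open>insert the trivial detour along \<open>g\<close> and back between the two loops\<close>
  have 2: "homotopic_paths S (g +++ p +++ q +++ ?g) (g +++ p +++ ?g +++ g +++ q +++ ?g)"
    by (rule homotopic_paths_join_right, rule homotopic_paths_join_right, rule homotopic_paths_sym,
        rule homotopic_paths_cancel_inverse) (simp_all add: facts)
  have 3: "homotopic_paths S (g +++ p +++ ?g +++ g +++ q +++ ?g) (g +++ (p +++ ?g) +++ g +++ q +++ ?g)"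
    by (rule homotopic_paths_join_right, rule homotopic_paths_assoc) (simp_all add: facts)
  have 4: "homotopic_paths S (g +++ (p +++ ?g) +++ g +++ q +++ ?g)
      ((g +++ p +++ ?g) +++ g +++ q +++ ?g)"
    by (rule homotopic_paths_assoc) (simp_all add: facts)
  have "path_class S (g +++ (p +++ q) +++ ?g)
      = path_class S ((g +++ p +++ ?g) +++ g +++ q +++ ?g)"
    using 1 2 3 4 path_class_eq by metis
  then show "pi1_transport S g (A \<otimes>\<^bsub>pi1 S y\<^esub> B)
      = pi1_transport S g A \<otimes>\<^bsub>pi1 S x\<^esub> pi1_transport S g B"
    using * g
    by (simp add: pi1_mult pi1_transport_path_class loops_at_join loops_at_conjugate)
qed

section \<open>Homotopies pushed forward from convex sets\<close>

lemma homotopic_paths_image_of_convex: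
  fixes p q :: "real \<Rightarrow> 'v::real_normed_vector"
  assumes "convex C" "continuous_on C G" "G ` C \<subseteq> S"
    and "path p" "path_image p \<subseteq> C" "path q" "path_image q \<subseteq> C"
    and "pathstart p = pathstart q" "pathfinish p = pathfinish q"
  shows "homotopic_paths S (G \<circ> p) (G \<circ> q)"
proof -
  have "homotopic_paths C p q"
  proof (rule homotopic_paths_linear)
    fix t :: real assume "t \<in> {0..1}"
    then have "p t \<in> C" "q t \<in> C"
      using assms(5,7) by (auto simp: path_image_def)
    then show "closed_segment (p t) (q t) \<subseteq> C"
      using \<open>convex C\<close> by (simp add: closed_segment_subset)
  qed (use assms in auto)
  then show ?thesis
    using assms(2,3) homotopic_paths_continuous_image by blast
qed

text \<open>The path along three sides of the unit square is homotopic to the fourth side, since the square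
  is convex. When \<open>G\<close> is a homotopy of loops, the first and third of these sides have the same image,
  namely the track of the base point.\<close>

lemma conjugate_along_homotopy:
  fixes G :: "real \<times> real \<Rightarrow> 'a::topological_space"
  assumes cont: "continuous_on ({0..1} \<times> {0..1}) G" and sub: "G ` ({0..1} \<times> {0..1}) \<subseteq> S"
    and per: "\<And>s. s \<in> {0..1} \<Longrightarrow> G (s, 1) = G (s, 0)"
  shows "homotopic_paths S
           ((\<lambda>s. G (s, 0)) +++ ((\<lambda>t. G (1, t)) +++ reversepath (\<lambda>s. G (s, 0)))) (\<lambda>t. G (0, t))"
proof -
  let ?C = "{0..1} \<times> {0..1::real} :: (real \<times> real) set"
  let ?a = "\<lambda>s::real. (s, 0::real)" and ?b = "\<lambda>t::real. (1::real, t)"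
    and ?c = "\<lambda>s::real. (1 - s, 1::real)" and ?d = "\<lambda>t::real. (0::real, t)"
  have paths: "path ?a" "path ?b" "path ?c" "path ?d"
    unfolding path_def by (auto intro!: continuous_intros)
  have images: "path_image ?a \<subseteq> ?C" "path_image ?b \<subseteq> ?C" "path_image ?c \<subseteq> ?C" "path_image ?d \<subseteq> ?C"
    by (auto simp: path_image_def)
  have ends: "pathstart ?a = (0,0)" "pathfinish ?a = (1,0)" "pathstart ?b = (1,0)"
    "pathfinish ?b = (1,1)" "pathstart ?c = (1,1)" "pathfinish ?c = (0,1)"
    "pathstart ?d = (0,0)" "pathfinish ?d = (0,1)"
    by (auto simp: pathstart_def pathfinish_def)
  have image: "homotopic_paths S (G \<circ> (?a +++ ?b +++ ?c)) (G \<circ> ?d)"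
  proof (rule homotopic_paths_image_of_convex[OF _ cont sub])
    show "convex ?C"
      by (simp add: convex_Times)
  qed (use paths images ends in \<open>auto simp: path_image_join\<close>)
  have "homotopic_paths S (G \<circ> (?a +++ ?b +++ ?c))
     ((\<lambda>s. G (s, 0)) +++ ((\<lambda>t. G (1, t)) +++ reversepath (\<lambda>s. G (s, 0))))"
  proof (rule homotopic_paths_eq)
    have "path (?a +++ ?b +++ ?c)" "path_image (?a +++ ?b +++ ?c) \<subseteq> ?C"
      using paths images ends by (auto simp: path_image_join)
    then show "path (G \<circ> (?a +++ ?b +++ ?c))" "path_image (G \<circ> (?a +++ ?b +++ ?c)) \<subseteq> S"
      using cont sub continuous_on_subset path_continuous_image
      by (blast, force simp: path_image_compose)
  qed (auto simp: joinpaths_def reversepath_def per field_simps)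
  then have "homotopic_paths S ((\<lambda>s. G (s, 0)) +++ ((\<lambda>t. G (1, t)) +++ reversepath (\<lambda>s. G (s, 0))))
      (G \<circ> ?d)"
    using image by (rule homotopic_paths_trans[OF homotopic_paths_sym])
  then show ?thesis
    by (simp add: o_def)
qed

lemma periodic_loop_in_loops_at:
  fixes G :: "'v::real_normed_vector \<Rightarrow> 'a::topological_space"
  assumes "continuous_on UNIV G" "range G \<subseteq> S" "\<And>x. G (x + l) = G x"
  shows "(\<lambda>t. G (t *\<^sub>R l)) \<in> loops_at S (G 0)"
proof (rule loops_atI)
  show "path (\<lambda>t. G (t *\<^sub>R l))"
    unfolding path_def
    by (rule continuous_on_compose2[OF assms(1)]) (auto intro!: continuous_intros)
qed (use assms(2) assms(3)[of 0] in \<open>auto simp: path_image_def pathstart_def pathfinish_def\<close>)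

text \<open>The loop of a sum is the image of a segment, which in the real vector space can be deformed into
  two consecutive segments; periodicity moves the second one back to the origin.\<close>

lemma periodic_loop_add:
  fixes G :: "'v::real_normed_vector \<Rightarrow> 'a::real_normed_vector"
  assumes cont: "continuous_on UNIV G" and sub: "range G \<subseteq> S"
    and k: "\<And>x. G (x + k) = G x" and l: "\<And>x. G (x + l) = G x"
  shows "path_class S (\<lambda>t. G (t *\<^sub>R (k + l)))
       = path_class S (\<lambda>t. G (t *\<^sub>R k)) \<otimes>\<^bsub>pi1 S (G 0)\<^esub> path_class S (\<lambda>t. G (t *\<^sub>R l))"
proof -
  have "homotopic_paths S (G \<circ> linepath 0 (k + l)) (G \<circ> (linepath 0 k +++ linepath k (k + l)))"
    using sub by (intro homotopic_paths_image_of_convex[OF convex_UNIV cont]) auto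
  moreover have "G \<circ> linepath 0 (k + l) = (\<lambda>t. G (t *\<^sub>R (k + l)))"
    by (auto simp: linepath_def)
  moreover have "G \<circ> (linepath 0 k +++ linepath k (k + l)) = (\<lambda>t. G (t *\<^sub>R k)) +++ (\<lambda>t. G (t *\<^sub>R l))"
  proof -
    have "(1 - t) *\<^sub>R k + t *\<^sub>R (k + l) = t *\<^sub>R l + k" for t
      by (simp add: algebra_simps)
    then show ?thesis
      by (auto simp: linepath_def joinpaths_def k fun_eq_iff)
  qed
  ultimately show ?thesis
    using periodic_loop_in_loops_at[OF cont sub k] periodic_loop_in_loops_at[OF cont sub l]
    by (simp add: pi1_mult path_class_eq)
qed

lemma periodic_loop_int_pow:
  fixes G :: "'v::real_normed_vector \<Rightarrow> 'a::real_normed_vector" and i :: int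
  assumes cont: "continuous_on UNIV G" and sub: "range G \<subseteq> S" and per: "\<And>x. G (x + l) = G x"
  shows "path_class S (\<lambda>t. G (t *\<^sub>R (of_int i *\<^sub>R l)))
       = path_class S (\<lambda>t. G (t *\<^sub>R l)) [^]\<^bsub>pi1 S (G 0)\<^esub> i"
proof -
  let ?h = "\<lambda>i::int. path_class S (\<lambda>t. G (t *\<^sub>R (of_int i *\<^sub>R l)))"
  have per_nat: "G (x + of_nat n *\<^sub>R l) = G x" for n x
  proof (induction n arbitrary: x)
    case (Suc n)
    have "G (x + of_nat (Suc n) *\<^sub>R l) = G ((x + of_nat n *\<^sub>R l) + l)"
      by (simp add: algebra_simps)
    then show ?case
      using per Suc by simp
  qed simp
  have per_int: "G (x + of_int i *\<^sub>R l) = G x" for i x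
  proof (cases i rule: int_cases2)
    case (nonpos n)
    then show ?thesis
      using per_nat[of "x - of_nat n *\<^sub>R l" n] by simp
  qed (use per_nat in simp)
  have hom: "?h \<in> hom integer_group (pi1 S (G 0))"
  proof (rule homI)
    fix i show "?h i \<in> carrier (pi1 S (G 0))"
      by (intro path_class_in_pi1 periodic_loop_in_loops_at cont sub per_int)
  next
    fix i j show "?h (i \<otimes>\<^bsub>integer_group\<^esub> j) = ?h i \<otimes>\<^bsub>pi1 S (G 0)\<^esub> ?h j"
      using periodic_loop_add[OF cont sub per_int[of _ i] per_int[of _ j]]
      by (simp add: scaleR_left_distrib)
  qed
  interpret group_hom integer_group "pi1 S (G 0)" ?h
    using hom group_pi1[of "G 0" S] sub
    by (auto simp: group_hom_def group_hom_axioms_def)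
  show ?thesis
    using hom_int_pow[of 1 i] by simp
qed

section \<open>Translations of the torus\<close>

definition translate :: "real \<times> real \<Rightarrow> pt \<Rightarrow> pt" where
  "translate v y = (fst y * cis (2 * pi * fst v), snd y * cis (2 * pi * snd v))"

lemma translate_0 [simp]: "translate 0 y = y"
  by (simp add: translate_def)

lemma translate_add: "translate v (translate w y) = translate (v + w) y"
  by (simp add: translate_def cis_mult algebra_simps)

lemma translate_in_torus: "y \<in> torus \<Longrightarrow> translate v y \<in> torus"
  by (auto simp: translate_def torus_def norm_mult)

lemma continuous_on_translate [continuous_intros]:
  assumes "continuous_on A f" "continuous_on A g"
  shows "continuous_on A (\<lambda>x. translate (f x) (g x))"
  unfolding translate_def by (intro continuous_intros assms)

lemma cis_2pi_eq_1_iff: "cis (2 * pi * x) = 1 \<longleftrightarrow> x \<in> \<int>"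
proof
  assume "cis (2 * pi * x) = 1"
  then obtain n where "2 * pi * x = of_int n * (2 * pi)"
    by (auto simp: cis_eq_1_iff)
  then have "x = of_int n"
    by simp
  then show "x \<in> \<int>"
    by simp
qed (rule cis_multiple_2pi)

lemma translate_eq_self_iff:
  assumes "y \<in> torus"
  shows "translate v y = y \<longleftrightarrow> fst v \<in> \<int> \<and> snd v \<in> \<int>"
proof -
  have "fst y \<noteq> 0" "snd y \<noteq> 0"
    using assms by (auto simp: torus_def)
  then show ?thesis
    by (simp add: translate_def prod_eq_iff cis_2pi_eq_1_iff)
qed

lemma translate_eq_iff:
  assumes "y \<in> torus"
  shows "translate v y = translate w y \<longleftrightarrow> translate (v - w) y = y"
proof
  assume "translate v y = translate w y"
  then have "translate (- w) (translate v y) = translate (- w) (translate w y)"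
    by simp
  then show "translate (v - w) y = y"
    by (simp add: translate_add)
next
  assume "translate (v - w) y = y"
  then have "translate w (translate (v - w) y) = translate w y"
    by simp
  then show "translate v y = translate w y"
    by (simp add: translate_add)
qed

lemma torus_orbit:
  assumes "y \<in> torus"
  obtains v where "y = translate v (1, 1)"
proof -
  have unit: "\<exists>x. c = cis (2 * pi * x)" if "norm c = 1" for c :: complex
  proof
    have "c \<noteq> 0"
      using that by auto
    then show "c = cis (2 * pi * (Arg c / (2 * pi)))"
      using that by (simp add: cis_Arg sgn_div_norm)
  qed
  have "norm (fst y) = 1" "norm (snd y) = 1"
    using assms by (auto simp: torus_def)
  then obtain x1 x2 where "fst y = cis (2 * pi * x1)" "snd y = cis (2 * pi * x2)"
    using unit by metis
  then have "y = translate (x1, x2) (1, 1)"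
    by (simp add: translate_def prod_eq_iff)
  then show ?thesis ..
qed

lemma meridian_eq_translate: "meridian z t = translate (t *\<^sub>R (1, 0)) z"
  by (simp add: meridian_def translate_def)

lemma longitude_eq_translate: "longitude z t = translate (t *\<^sub>R (0, 1)) z"
  by (simp add: longitude_def translate_def)

text \<open>The identification of the integer lattice with \<open>pi1 torus y\<close>: a lattice vector is sent to the
  straight loop in its direction. It makes \<open>Ab\<close> comparable with the first projection.\<close>

definition translation_class :: "pt \<Rightarrow> int \<times> int \<Rightarrow> (real \<Rightarrow> pt) set" where
  "translation_class y ij =
     path_class torus (\<lambda>t. translate (t *\<^sub>R (of_int (fst ij), of_int (snd ij))) y)"

lemma translation_loop:
  assumes "y \<in> torus"
  shows "(\<lambda>t. translate (t *\<^sub>R (of_int i, of_int j)) y) \<in> loops_at torus y"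
proof -
  have "translate (v + (of_int i, of_int j)) y = translate v y" for v
    using assms by (simp add: translate_eq_iff translate_eq_self_iff)
  moreover have "continuous_on UNIV (\<lambda>v. translate v y)" "range (\<lambda>v. translate v y) \<subseteq> torus"
    using assms by (auto simp: translate_in_torus intro!: continuous_intros)
  ultimately show ?thesis
    using periodic_loop_in_loops_at[of "\<lambda>v. translate v y" torus "(of_int i, of_int j)"] by simp
qed

lemma translation_class_hom:
  assumes y: "y \<in> torus"
  shows "translation_class y \<in> hom Z2 (pi1 torus y)"
proof (rule homI)
  fix k show "translation_class y k \<in> carrier (pi1 torus y)"
    unfolding translation_class_def by (intro path_class_in_pi1 translation_loop y)
next
  fix k l :: "int \<times> int"
  have per: "translate (v + (of_int i, of_int j)) y = translate v y" for v i j
    using y by (simp add: translate_eq_iff translate_eq_self_iff)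
  have "path_class torus (\<lambda>t. translate (t *\<^sub>R ((of_int (fst k), of_int (snd k)) + (of_int (fst l), of_int (snd l)))) y)
    = translation_class y k \<otimes>\<^bsub>pi1 torus (translate 0 y)\<^esub> translation_class y l"
    unfolding translation_class_def
    by (intro periodic_loop_add[of "\<lambda>v. translate v y"] per)
      (auto simp: y translate_in_torus intro!: continuous_intros)
  then show "translation_class y (k \<otimes>\<^bsub>Z2\<^esub> l)
    = translation_class y k \<otimes>\<^bsub>pi1 torus y\<^esub> translation_class y l"
    by (cases k; cases l) (simp add: translation_class_def)
qed

text \<open>The logarithmic derivative of this curve is constant, so its contour integral is immediate.\<close>

lemma winding_number_cis:
  fixes k :: real
  assumes "c \<noteq> 0"
  shows "winding_number (\<lambda>t. c * cis (2 * pi * (t * k))) 0 = of_real k"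
proof -
  let ?g = "\<lambda>t. c * cis (2 * pi * (t * k))"
  have deriv: "(?g has_vector_derivative 2 * pi * \<i> * k * ?g t) (at t)" for t
    unfolding cis_conv_exp
    by (auto intro!: derivative_eq_intros has_vector_derivative_real_field simp: algebra_simps)
  have "?g C1_differentiable_on {0..1}"
    unfolding C1_differentiable_on_def using deriv
    by (intro exI[of _ "\<lambda>t. 2 * pi * \<i> * k * ?g t"]) (auto intro!: continuous_intros)
  then have "valid_path ?g"
    by (simp add: valid_path_def C1_differentiable_imp_piecewise)
  moreover have "0 \<notin> path_image ?g"
    using assms by (auto simp: path_image_def)
  ultimately have "winding_number ?g 0 = 1 / (2 * pi * \<i>) * contour_integral ?g (\<lambda>w. 1 / (w - 0))"
    by (rule winding_number_valid_path)
  also have "contour_integral ?g (\<lambda>w. 1 / (w - 0)) = integral {0..1} (\<lambda>t::real. 2 * pi * \<i> * k)"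
    unfolding contour_integral_integral vector_derivative_at[OF deriv]
    using assms by simp
  finally show ?thesis
    by simp
qed

lemma inj_translation_class:
  assumes y: "y \<in> torus"
  shows "inj (translation_class y)"
proof (rule injI)
  fix k l assume eq: "translation_class y k = translation_class y l"
  let ?p = "\<lambda>k t. translate (t *\<^sub>R (of_int (fst k), of_int (snd k))) y"
  have "homotopic_paths torus (?p k) (?p l)"
    using eq loops_atD[OF translation_loop[OF y]]
    by (subst path_class_eq_iff[symmetric]) (auto simp: translation_class_def)
  then have "homotopic_paths (- {0}) (f \<circ> ?p k) (f \<circ> ?p l)"
    if "continuous_on torus f" "f ` torus \<subseteq> - {0}" for f :: "pt \<Rightarrow> complex"
    by (rule homotopic_paths_continuous_image) (use that in auto)
  then have w: "winding_number (f \<circ> ?p k) 0 = winding_number (f \<circ> ?p l) 0"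
    if "continuous_on torus f" "f ` torus \<subseteq> - {0}" for f :: "pt \<Rightarrow> complex"
    using that winding_number_homotopic_paths by blast
  have "continuous_on torus fst" "continuous_on torus snd"
    by (auto intro!: continuous_intros)
  moreover have "fst y \<noteq> 0" "snd y \<noteq> 0"
    using y by (auto simp: torus_def)
  moreover have "fst ` torus \<subseteq> - {0}" "snd ` torus \<subseteq> - {0}"
    by (auto simp: torus_def)
  ultimately have "complex_of_real (of_int (fst k)) = of_real (of_int (fst l))"
    "complex_of_real (of_int (snd k)) = of_real (of_int (snd l))"
    using w[of fst] w[of snd]
    by (auto simp: o_def translate_def winding_number_cis)
  then show "k = l"
    by (simp add: prod_eq_iff)
qed

section \<open>Homomorphisms out of a group with a free basis\<close>

lemma hom_word_value_eq:
  assumes "group G" "group H" "f \<in> hom G H" "g \<in> hom G H"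
    and "S \<subseteq> carrier G" "\<And>x. x \<in> S \<Longrightarrow> f x = g x" "ws \<in> lists (S \<times> UNIV)"
  shows "word_value G ws \<in> carrier G \<and> f (word_value G ws) = g (word_value G ws)"
proof -
  interpret f: group_hom G H f
    using assms by (simp add: group_hom_def group_hom_axioms_def)
  interpret g: group_hom G H g
    using assms by (simp add: group_hom_def group_hom_axioms_def)
  show ?thesis
    using assms(7)
  proof (induction ws)
    case Nil
    then show ?case
      by (simp add: word_value_def)
  next
    case (Cons a ws)
    obtain x e where a: "a = (x, e)"
      by (cases a)
    then have x: "x \<in> carrier G" "f x = g x"
      using Cons assms(5,6) by auto
    have "word_value G (a # ws)
        = (if e then x else inv\<^bsub>G\<^esub> x) \<otimes>\<^bsub>G\<^esub> word_value G ws"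
      by (simp add: word_value_def a)
    then show ?case
      using x Cons by simp
  qed
qed

lemma hom_eq_on_free_basis:
  assumes "group G" "group H" "f \<in> hom G H" "g \<in> hom G H"
    and "free_basis G S" "\<And>x. x \<in> S \<Longrightarrow> f x = g x" "y \<in> carrier G"
  shows "f y = g y"
proof -
  have "S \<subseteq> carrier G" and "y \<in> word_value G ` {ws \<in> lists (S \<times> UNIV). reduced_word ws}"
    using assms(5,7) by (auto simp: free_basis_def bij_betw_def)
  then show ?thesis
    using hom_word_value_eq[of G H f g S] assms by blast
qed

section \<open>Loops of pairs of points\<close>

text \<open>In \<open>pair_flow k (x, v)\<close> the vector \<open>v\<close> moves both points and \<open>x\<close> moves the first point alone in
  direction \<open>k\<close>. The three parameters correspond to the factors of \<open>P2_elem\<close>.\<close>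

definition pair_flow :: "real \<times> real \<Rightarrow> real \<times> real \<times> real \<Rightarrow> pt \<times> pt \<Rightarrow> pt \<times> pt" where
  "pair_flow k \<tau> Q = (translate (fst \<tau> *\<^sub>R k + snd \<tau>) (fst Q), translate (snd \<tau>) (snd Q))"

lemma pair_flow_0 [simp]: "pair_flow k 0 Q = Q"
  by (simp add: pair_flow_def)

lemma continuous_on_pair_flow [continuous_intros]:
  assumes "continuous_on A f" "continuous_on A g"
  shows "continuous_on A (\<lambda>x. pair_flow k (f x) (g x))"
  unfolding pair_flow_def by (intro continuous_intros assms)

text \<open>Undoing the common translation reduces a collision to one where only the first point has moved.\<close>

lemma pair_flow_in_config2:
  assumes Q: "Q \<in> config2 torus" and avoid: "\<And>x. translate (x *\<^sub>R k) (fst Q) \<noteq> snd Q"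
  shows "pair_flow k \<tau> Q \<in> config2 torus"
proof -
  have "translate (fst \<tau> *\<^sub>R k + snd \<tau>) (fst Q) \<noteq> translate (snd \<tau>) (snd Q)"
  proof
    assume "translate (fst \<tau> *\<^sub>R k + snd \<tau>) (fst Q) = translate (snd \<tau>) (snd Q)"
    then have "translate (- snd \<tau>) (translate (fst \<tau> *\<^sub>R k + snd \<tau>) (fst Q))
      = translate (- snd \<tau>) (translate (snd \<tau>) (snd Q))"
      by simp
    then have "translate (fst \<tau> *\<^sub>R k) (fst Q) = snd Q"
      unfolding translate_add by simp
    then show False
      using avoid by blast
  qed
  then show ?thesis
    using Q by (auto simp: config2_def pair_flow_def translate_in_torus)
qed

lemma pair_flow_periodic:
  assumes Q: "Q \<in> config2 torus"
    and \<tau>: "fst \<tau> *\<^sub>R k + snd \<tau> \<in> \<int> \<times> \<int>" "snd \<tau> \<in> \<int> \<times> \<int>"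
  shows "pair_flow k (\<sigma> + \<tau>) Q = pair_flow k \<sigma> Q"
proof -
  have shift: "translate (v + d) y = translate v y" if "y \<in> torus" "d \<in> \<int> \<times> \<int>" for v d y
    using that by (auto simp: translate_eq_iff translate_eq_self_iff)
  have sum: "fst (\<sigma> + \<tau>) *\<^sub>R k + snd (\<sigma> + \<tau>) = (fst \<sigma> *\<^sub>R k + snd \<sigma>) + (fst \<tau> *\<^sub>R k + snd \<tau>)"
    by (simp add: algebra_simps)
  have "fst Q \<in> torus" "snd Q \<in> torus"
    using Q by (auto simp: config2_def)
  then show ?thesis
    unfolding pair_flow_def sum using \<tau> by (simp only: shift snd_add)
qed

text \<open>Common translations act on all pairs of distinct points at once. Applied to a path of pairs, a
  loop of them is a homotopy between the loops at the two ends of the path. This identifies the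
  transported loops with the central generators whatever path is used.\<close>

lemma transport_diagonal_translation:
  fixes i j :: int
  assumes \<gamma>: "path \<gamma>" "path_image \<gamma> \<subseteq> config2 torus" "pathstart \<gamma> = xx" "pathfinish \<gamma> = Q"
  defines "loop \<equiv> \<lambda>P t. pair_flow 0 (t *\<^sub>R (0, of_int i, of_int j)) P"
  shows "pi1_transport (config2 torus) \<gamma> (path_class (config2 torus) (loop Q))
       = path_class (config2 torus) (loop xx)"
proof -
  let ?C = "config2 torus" and ?G = "\<lambda>(s, t). loop (\<gamma> s) t"
  have \<gamma>C: "\<gamma> s \<in> ?C" if "s \<in> {0..1}" for s
    using that \<gamma>(2) by (auto simp: path_image_def)
  have C: "pair_flow 0 \<tau> P \<in> ?C" if "P \<in> ?C" for P \<tau>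
    using that by (intro pair_flow_in_config2) (auto simp: config2_def)
  have per: "pair_flow 0 (\<sigma> + (0, of_int i, of_int j)) P = pair_flow 0 \<sigma> P" if "P \<in> ?C" for P \<sigma>
    using that by (intro pair_flow_periodic) auto
  have Q: "Q \<in> ?C"
    using \<gamma>C[of 1] \<gamma>(4) by (simp add: pathfinish_def)
  have "loop Q \<in> loops_at ?C (pair_flow 0 0 Q)"
    unfolding loop_def
    by (rule periodic_loop_in_loops_at[of "\<lambda>\<tau>. pair_flow 0 \<tau> Q"])
      (use C[OF Q] per[OF Q] in \<open>auto intro!: continuous_intros\<close>)
  then have 1: "pi1_transport ?C \<gamma> (path_class ?C (loop Q))
      = path_class ?C (\<gamma> +++ (loop Q +++ reversepath \<gamma>))"
    using \<gamma> by (simp add: pi1_transport_path_class)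
  have "homotopic_paths ?C ((\<lambda>s. ?G (s, 0)) +++ ((\<lambda>t. ?G (1, t)) +++ reversepath (\<lambda>s. ?G (s, 0))))
      (\<lambda>t. ?G (0, t))"
  proof (rule conjugate_along_homotopy)
    have "continuous_on ({0..1} \<times> {0..1::real}) (\<lambda>x. \<gamma> (fst x))"
      using \<gamma>(1) unfolding path_def
      by (rule continuous_on_compose2) (auto intro!: continuous_intros)
    then show "continuous_on ({0..1} \<times> {0..1}) ?G"
      unfolding loop_def split_def by (intro continuous_intros)
    show "?G ` ({0..1} \<times> {0..1}) \<subseteq> ?C"
      by (intro image_subsetI) (simp add: split_beta mem_Times_iff loop_def C \<gamma>C)
    show "?G (s, 1) = ?G (s, 0)" if "s \<in> {0..1}" for s
      using per[OF \<gamma>C[OF that], of 0] by (simp add: loop_def zero_prod_def[symmetric])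
  qed
  moreover have "(\<lambda>s. ?G (s, 0)) = \<gamma>" "(\<lambda>t. ?G (1, t)) = loop Q" "(\<lambda>t. ?G (0, t)) = loop xx"
    using \<gamma>(3,4) by (auto simp: loop_def pathstart_def pathfinish_def zero_prod_def[symmetric])
  ultimately have "homotopic_paths ?C (\<gamma> +++ (loop Q +++ reversepath \<gamma>)) (loop xx)"
    by simp
  then show ?thesis
    unfolding 1 by (rule path_class_eq)
qed

lemma group_P2: "xx \<in> config2 torus \<Longrightarrow> group (P2 xx)"
  unfolding P2_def by (rule group_pi1)

lemma fst_config2: "continuous_on (config2 S) fst" "fst ` config2 S \<subseteq> S"
  and snd_config2: "continuous_on (config2 S) snd" "snd ` config2 S \<subseteq> S"
  by (auto simp: config2_def intro!: continuous_intros)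

lemma subgroup_fibre:
  assumes xx: "xx \<in> config2 torus"
  shows "subgroup (kernel (P2 xx) (pi1 torus (snd xx)) (pi1_map torus snd)) (P2 xx)"
proof -
  have "snd xx \<in> torus"
    using xx by (auto simp: config2_def)
  then interpret group_hom "P2 xx" "pi1 torus (snd xx)" "pi1_map torus snd"
    using pi1_map_hom[OF snd_config2(1) snd_config2(2), of torus xx] group_P2[OF xx]
    by (simp add: group_hom_def group_hom_axioms_def P2_def group_pi1)
  show ?thesis
    by (rule subgroup_kernel)
qed

lemma group_fibre_group:
  assumes "xx \<in> config2 torus"
  shows "group (fibre_group xx)"
  unfolding fibre_group_def
  using subgroup.subgroup_is_group[OF subgroup_fibre[OF assms] group_P2[OF assms]] .

text \<open>A coordinate of the conjugated loop is a conjugate, in the torus, of a loop of translations, and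
  there every loop of translations may be slid back along the conjugating path. For \<open>f = snd\<close> this
  gives membership in the kernel, for \<open>f = fst\<close> the image in \<open>pi1 torus\<close>.\<close>

lemma projection_of_transported_loop:
  fixes i j :: int and f :: "pt \<times> pt \<Rightarrow> pt"
  assumes \<gamma>: "path \<gamma>" "path_image \<gamma> \<subseteq> config2 torus" "pathstart \<gamma> = xx" "pathfinish \<gamma> = Q"
    and f: "continuous_on (config2 torus) f" "f ` config2 torus \<subseteq> torus"
    and p: "p \<in> loops_at (config2 torus) Q"
    and fp: "\<And>t. f (p t) = translate (t *\<^sub>R (of_int i, of_int j)) (f Q)"
  shows "pi1_map torus f (pi1_transport (config2 torus) \<gamma> (path_class (config2 torus) p))
       = translation_class (f xx) (i, j)"
proof -
  let ?C = "config2 torus" and ?G = "\<lambda>(s, t). translate (t *\<^sub>R (of_int i, of_int j)) (f (\<gamma> s))"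
  have f\<gamma>: "f (\<gamma> s) \<in> torus" if "s \<in> {0..1}" for s
    using that \<gamma>(2) f(2) unfolding path_image_def by blast
  have 1: "pi1_map torus f (pi1_transport ?C \<gamma> (path_class ?C p))
      = path_class torus (f \<circ> (\<gamma> +++ (p +++ reversepath \<gamma>)))"
    using \<gamma> p f loops_at_conjugate[OF \<gamma> p]
    by (simp add: pi1_transport_path_class pi1_map_path_class)
  have "homotopic_paths torus ((\<lambda>s. ?G (s, 0)) +++ ((\<lambda>t. ?G (1, t)) +++ reversepath (\<lambda>s. ?G (s, 0))))
      (\<lambda>t. ?G (0, t))"
  proof (rule conjugate_along_homotopy)
    have "continuous_on {0..1} (f \<circ> \<gamma>)"
      using path_continuous_image[OF \<gamma>(1) continuous_on_subset[OF f(1) \<gamma>(2)]] by (simp add: path_def)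
    then have "continuous_on ({0..1} \<times> {0..1::real}) (\<lambda>x. (f \<circ> \<gamma>) (fst x))"
      by (rule continuous_on_compose2) (auto intro!: continuous_intros)
    then show "continuous_on ({0..1} \<times> {0..1}) ?G"
      unfolding split_def o_def by (intro continuous_intros)
    show "?G ` ({0..1} \<times> {0..1}) \<subseteq> torus"
      using f\<gamma> by (auto simp: translate_in_torus)
    show "?G (s, 1) = ?G (s, 0)" if "s \<in> {0..1}" for s
      using f\<gamma>[OF that] by (simp add: translate_eq_iff translate_eq_self_iff zero_prod_def[symmetric])
  qed
  moreover have "(\<lambda>s. ?G (s, 0)) = f \<circ> \<gamma>" "(\<lambda>t. ?G (1, t)) = f \<circ> p"
    "(\<lambda>t. ?G (0, t)) = (\<lambda>t. translate (t *\<^sub>R (of_int i, of_int j)) (f xx))"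
    using \<gamma>(3,4) fp by (auto simp: pathstart_def pathfinish_def zero_prod_def[symmetric])
  moreover have "f \<circ> (\<gamma> +++ (p +++ reversepath \<gamma>))
      = (f \<circ> \<gamma>) +++ ((f \<circ> p) +++ reversepath (f \<circ> \<gamma>))"
    by (simp add: path_compose_join path_compose_reversepath)
  ultimately have "homotopic_paths torus (f \<circ> (\<gamma> +++ (p +++ reversepath \<gamma>)))
      (\<lambda>t. translate (t *\<^sub>R (of_int i, of_int j)) (f xx))"
    by simp
  then show ?thesis
    unfolding 1 translation_class_def by (simp add: path_class_eq)
qed

text \<open>All three factors of the product decomposition come from one additive family of loops, so
  transporting the loop of \<open>(r, a, b)\<close> amounts to transporting the loops of the three unit vectors.\<close>

lemma transport_pair_flow:
  fixes m n :: int
  assumes Q: "Q \<in> config2 torus"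
    and \<gamma>: "path \<gamma>" "path_image \<gamma> \<subseteq> config2 torus" "pathstart \<gamma> = xx" "pathfinish \<gamma> = Q"
    and avoid: "\<And>x. translate (x *\<^sub>R (of_int m, of_int n)) (fst Q) \<noteq> snd Q"
  defines "transported \<equiv> \<lambda>\<tau>. pi1_transport (config2 torus) \<gamma>
      (path_class (config2 torus) (\<lambda>t. pair_flow (of_int m, of_int n) (t *\<^sub>R \<tau>) Q))"
  shows "transported (1, 0, 0) \<in> carrier (fibre_group xx)"
    and "pi1_map torus fst (transported (1, 0, 0)) = translation_class (fst xx) (m, n)"
    and "\<And>r a b :: int. transported (of_int r, of_int a, of_int b)
           = P2_elem xx (transported (1, 0, 0) [^]\<^bsub>fibre_group xx\<^esub> r) (a, b)"
proof -
  let ?C = "config2 torus" and ?k = "(of_int m, of_int n) :: real \<times> real"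
  let ?T = "pi1_transport ?C \<gamma>"
  let ?p = "\<lambda>\<tau> t. pair_flow ?k (t *\<^sub>R \<tau>) Q"
  let ?c = "\<lambda>\<tau>. path_class ?C (?p \<tau>)"
  let ?w = "transported (1, 0, 0)"
  have xx: "xx \<in> ?C"
    using \<gamma> pathstart_in_path_image by blast
  have cont: "continuous_on UNIV (\<lambda>\<tau>. pair_flow ?k \<tau> Q)"
    by (intro continuous_intros)
  have sub: "range (\<lambda>\<tau>. pair_flow ?k \<tau> Q) \<subseteq> ?C"
    using pair_flow_in_config2[OF Q avoid] by blast
  have per: "pair_flow ?k (\<sigma> + (of_int r, of_int a, of_int b)) Q = pair_flow ?k \<sigma> Q" for \<sigma> and r a b :: int
    using Q by (intro pair_flow_periodic) auto
  have loop: "?p (of_int r, of_int a, of_int b) \<in> loops_at ?C Q" for r a b :: int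
    using periodic_loop_in_loops_at[OF cont sub per] by simp
  have add: "?c ((of_int r, of_int a, of_int b) + (of_int r', of_int a', of_int b'))
      = ?c (of_int r, of_int a, of_int b) \<otimes>\<^bsub>pi1 ?C Q\<^esub> ?c (of_int r', of_int a', of_int b')"
    for r a b r' a' b' :: int
    using periodic_loop_add[OF cont sub per per] by simp
  have pow: "?c (of_int i *\<^sub>R (of_int r, of_int a, of_int b)) = ?c (of_int r, of_int a, of_int b) [^]\<^bsub>pi1 ?C Q\<^esub> i"
    for i r a b :: int
    using periodic_loop_int_pow[OF cont sub per] by simp
  interpret P2: group "P2 xx"
    by (rule group_P2[OF xx])
  interpret T: group_hom "pi1 ?C Q" "P2 xx" ?T
    using pi1_transport_hom[OF \<gamma>] group_pi1[OF Q]
    by (simp add: group_hom_def group_hom_axioms_def P2_def group_pi1 xx)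
  have cc: "?c (of_int r, of_int a, of_int b) \<in> carrier (pi1 ?C Q)" for r a b :: int
    by (intro path_class_in_pi1 loop)
  have generators: "?c (1, 0, 0) \<in> carrier (pi1 ?C Q)" "?c (0, 1, 0) \<in> carrier (pi1 ?C Q)"
      "?c (0, 0, 1) \<in> carrier (pi1 ?C Q)"
    using cc[of 1 0 0] cc[of 0 1 0] cc[of 0 0 1] by simp_all
  have T_prod: "?T (A [^]\<^bsub>pi1 ?C Q\<^esub> r \<otimes>\<^bsub>pi1 ?C Q\<^esub> B [^]\<^bsub>pi1 ?C Q\<^esub> a \<otimes>\<^bsub>pi1 ?C Q\<^esub> D [^]\<^bsub>pi1 ?C Q\<^esub> b)
      = ?T A [^]\<^bsub>P2 xx\<^esub> r \<otimes>\<^bsub>P2 xx\<^esub> ?T B [^]\<^bsub>P2 xx\<^esub> a \<otimes>\<^bsub>P2 xx\<^esub> ?T D [^]\<^bsub>P2 xx\<^esub> b"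
    if "A \<in> carrier (pi1 ?C Q)" "B \<in> carrier (pi1 ?C Q)" "D \<in> carrier (pi1 ?C Q)"
    for A B D and r a b :: int
    using that by (simp add: T.hom_int_pow)
  have wc: "?w \<in> carrier (P2 xx)"
    unfolding transported_def by (rule T.hom_closed[OF generators(1)])
  have "pi1_map torus snd ?w = translation_class (snd xx) (0, 0)"
    unfolding transported_def
    by (rule projection_of_transported_loop[OF \<gamma> snd_config2(1) snd_config2(2)])
      (use loop[of 1 0 0] in \<open>simp_all add: pair_flow_def zero_prod_def[symmetric]\<close>)
  also have "\<dots> = \<one>\<^bsub>pi1 torus (snd xx)\<^esub>"
    by (simp add: translation_class_def pi1_one linepath_def zero_prod_def[symmetric])
  finally show w: "?w \<in> carrier (fibre_group xx)"
    using wc by (simp add: fibre_group_def kernel_def)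
  show "pi1_map torus fst ?w = translation_class (fst xx) (m, n)"
    unfolding transported_def
    by (rule projection_of_transported_loop[OF \<gamma> fst_config2(1) fst_config2(2)])
      (use loop[of 1 0 0] in \<open>simp_all add: pair_flow_def zero_prod_def[symmetric]\<close>)
  have diag: "?p (0, v) = (\<lambda>t. pair_flow 0 (t *\<^sub>R (0, v)) Q)" for v
    by (simp add: pair_flow_def zero_prod_def[symmetric])
  have x: "?T (?c (0, 1, 0)) = central_x xx"
    using transport_diagonal_translation[OF \<gamma>, of 1 0]
    by (simp add: diag central_x_def meridian_eq_translate pair_flow_def)
  have y: "?T (?c (0, 0, 1)) = central_y xx"
    using transport_diagonal_translation[OF \<gamma>, of 0 1]
    by (simp add: diag central_y_def longitude_eq_translate pair_flow_def)
  show "transported (of_int r, of_int a, of_int b) = P2_elem xx (?w [^]\<^bsub>fibre_group xx\<^esub> r) (a, b)"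
    for r a b :: int
  proof -
    have "?c (of_int r, of_int a, of_int b)
        = ?c (1, 0, 0) [^]\<^bsub>pi1 ?C Q\<^esub> r \<otimes>\<^bsub>pi1 ?C Q\<^esub> ?c (0, 1, 0) [^]\<^bsub>pi1 ?C Q\<^esub> a
          \<otimes>\<^bsub>pi1 ?C Q\<^esub> ?c (0, 0, 1) [^]\<^bsub>pi1 ?C Q\<^esub> b"
      using add[of r 0 0 0 a 0] add[of r a 0 0 0 b] pow[of r 1 0 0] pow[of a 0 1 0] pow[of b 0 0 1]
      by simp
    then have "?T (?c (of_int r, of_int a, of_int b))
        = ?w [^]\<^bsub>P2 xx\<^esub> r \<otimes>\<^bsub>P2 xx\<^esub> central_x xx [^]\<^bsub>P2 xx\<^esub> a
          \<otimes>\<^bsub>P2 xx\<^esub> central_y xx [^]\<^bsub>P2 xx\<^esub> b"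
      by (simp only: T_prod[OF generators] x y transported_def)
    moreover have "?w [^]\<^bsub>P2 xx\<^esub> r = ?w [^]\<^bsub>fibre_group xx\<^esub> r"
      using P2.int_pow_consistent[OF subgroup_fibre[OF xx]] w by (simp add: fibre_group_def)
    ultimately show ?thesis
      by (simp add: transported_def P2_elem_def)
  qed
qed

section \<open>Pairs of affine maps\<close>

text \<open>In exponential coordinates this is the affine map with linear part the matrix with columns
  \<open>(a, b)\<close> and \<open>(c, d)\<close>. Integer powers make it visibly a function on the torus.\<close>

definition torus_affine :: "pt \<Rightarrow> int \<Rightarrow> int \<Rightarrow> int \<Rightarrow> int \<Rightarrow> pt \<Rightarrow> pt" where
  "torus_affine e a b c d z =
     (fst e * fst z powi a * snd z powi c, snd e * fst z powi b * snd z powi d)"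

lemma torus_affine_translate:
  "torus_affine e a b c d (translate v z)
   = translate (fst v *\<^sub>R (of_int a, of_int b) + snd v *\<^sub>R (of_int c, of_int d)) (torus_affine e a b c d z)"
  by (simp add: torus_affine_def translate_def power_int_mult_distrib cis_power_int cis_mult
      algebra_simps flip: cis_mult)

lemma torus_affine_one: "torus_affine e a b c d (1, 1) = e"
  by (simp add: torus_affine_def)

lemma torus_affine_id: "torus_affine (1, 1) 1 0 0 1 z = z"
  by (simp add: torus_affine_def)

lemma continuous_on_torus_affine: "continuous_on torus (torus_affine e a b c d)"
  unfolding torus_affine_def by (intro continuous_intros) (auto simp: torus_def)

lemma torus_affine_in_torus: "e \<in> torus \<Longrightarrow> z \<in> torus \<Longrightarrow> torus_affine e a b c d z \<in> torus"
  by (auto simp: torus_affine_def torus_def norm_mult norm_power_int)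

text \<open>By \<open>rows\<close> the difference of the linear parts takes values in the line spanned by \<open>g\<close>. A coincidence
  would therefore be a lattice point on a translate of that line. The extra translation by multiples
  of \<open>g\<close> is allowed since the flow on pairs moves the first point in that direction.\<close>

lemma torus_affine_no_coincidence:
  fixes a b c d a' b' c' d' k l g1 g2 :: int
  assumes z: "z \<in> torus"
    and rows: "(a - a', b - b') = (k * g1, k * g2)" "(c - c', d - d') = (l * g1, l * g2)"
    and avoid: "\<And>x. x *\<^sub>R (of_int g1, of_int g2) + (\<alpha> - \<alpha>') \<notin> \<int> \<times> \<int>"
  shows "translate (y *\<^sub>R (of_int g1, of_int g2)) (torus_affine (translate \<alpha> (1, 1)) a b c d z)
       \<noteq> torus_affine (translate \<alpha>' (1, 1)) a' b' c' d' z"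
proof
  let ?g = "(of_int g1, of_int g2) :: real \<times> real"
  assume eq: "translate (y *\<^sub>R ?g) (torus_affine (translate \<alpha> (1, 1)) a b c d z)
       = torus_affine (translate \<alpha>' (1, 1)) a' b' c' d' z"
  obtain v where v: "z = translate v (1, 1)"
    using torus_orbit z by blast
  let ?A = "fst v *\<^sub>R (of_int a, of_int b) + snd v *\<^sub>R (of_int c, of_int d) :: real \<times> real"
    and ?A' = "fst v *\<^sub>R (of_int a', of_int b') + snd v *\<^sub>R (of_int c', of_int d') :: real \<times> real"
  have "translate (y *\<^sub>R ?g + (?A + \<alpha>)) (1, 1) = translate (?A' + \<alpha>') (1, 1)"
    using eq unfolding v torus_affine_translate torus_affine_one translate_add .
  moreover have one: "(1, 1) \<in> torus"
    by (simp add: torus_def)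
  ultimately have "translate (y *\<^sub>R ?g + (?A + \<alpha>) - (?A' + \<alpha>')) (1, 1) = (1, 1)"
    by (simp add: translate_eq_iff)
  then have int: "y *\<^sub>R ?g + (?A + \<alpha>) - (?A' + \<alpha>') \<in> \<int> \<times> \<int>"
    using one by (simp only: translate_eq_self_iff mem_Times_iff)
  have "real_of_int (a - a') = of_int (k * g1)" "real_of_int (b - b') = of_int (k * g2)"
    "real_of_int (c - c') = of_int (l * g1)" "real_of_int (d - d') = of_int (l * g2)"
    using rows by auto
  then have r: "real_of_int a = a' + k * g1" "real_of_int b = b' + k * g2"
    "real_of_int c = c' + l * g1" "real_of_int d = d' + l * g2"
    by simp_all
  have "y *\<^sub>R ?g + (?A + \<alpha>) - (?A' + \<alpha>') = (y + fst v * k + snd v * l) *\<^sub>R ?g + (\<alpha> - \<alpha>')"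
    unfolding r by (simp add: prod_eq_iff algebra_simps)
  then have "(y + fst v * k + snd v * l) *\<^sub>R ?g + (\<alpha> - \<alpha>') \<in> \<int> \<times> \<int>"
    using int by (simp only:)
  then show False
    by (rule notE[OF avoid])
qed

text \<open>Both the line through \<open>\<alpha>\<close> and the line through \<open>2 \<alpha>\<close> have to miss the lattice, as the
  differences of the translation parts of the two maps and the identity are \<open>\<alpha>\<close> and \<open>2 \<alpha>\<close>. A shift by
  a third along one coordinate axis works: either that coordinate is otherwise constantly zero on the
  line, or integrality of the other coordinate makes \<open>x\<close> an integer, and then the shifted coordinate
  differs from an integer by \<open>1 / 3\<close> or \<open>2 / 3\<close>.\<close>

lemma line_avoiding_lattice:
  fixes g :: "int \<times> int"
  assumes "(\<exists>q. g = (0, q) \<or> g = (1, q)) \<or> (\<exists>p. g = (p, 0) \<or> g = (p, 1))"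
  obtains \<alpha> :: "real \<times> real"
    where "\<And>x. x *\<^sub>R (of_int (fst g), of_int (snd g)) + \<alpha> \<notin> \<int> \<times> \<int>"
      and "\<And>x. x *\<^sub>R (of_int (fst g), of_int (snd g)) + 2 *\<^sub>R \<alpha> \<notin> \<int> \<times> \<int>"
proof -
  have third: "(1 / 3 :: real) \<notin> \<int>" "(2 / 3 :: real) \<notin> \<int>"
    by (auto elim!: Ints_cases)
  have shifted: "real_of_int q * x + y \<notin> \<int>" if "x \<in> \<int>" "y \<notin> \<int>" for q x y
    using that by (metis Ints_diff Ints_mult Ints_of_int add_diff_cancel_left')
  consider q where "g = (0, q)" | q where "g = (1, q)" | p where "g = (p, 0)" | p where "g = (p, 1)"
    using assms by blast
  then show ?thesis
  proof cases
    case 1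
    then show ?thesis
      using third by (intro that[of "(1 / 3, 0)"]) auto
  next
    case (2 q)
    then show ?thesis
      using third shifted[of _ _ q] by (intro that[of "(0, 1 / 3)"]) (auto simp: mult.commute)
  next
    case 3
    then show ?thesis
      using third by (intro that[of "(0, 1 / 3)"]) auto
  next
    case (4 p)
    then show ?thesis
      using third shifted[of _ _ p] by (intro that[of "(1 / 3, 0)"]) (auto simp: mult.commute)
  qed
qed

lemma generate_Z2_multiple:
  assumes "h \<in> generate Z2 {g}"
  obtains k where "h = (k * fst g, k * snd g)"
proof -
  have "\<exists>k. h = (k * fst g, k * snd g)"
    using assms
  proof (induction rule: generate.induct)
    case one
    show ?case by (intro exI[of _ 0]) simp
  next
    case (incl h)
    then show ?case by (intro exI[of _ 1]) simp
  next
    case (inv h)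
    then show ?case by (intro exI[of _ "-1"]) (cases g, simp)
  next
    case (eng h1 h2)
    then obtain k1 k2 where "h1 = (k1 * fst g, k1 * snd g)" "h2 = (k2 * fst g, k2 * snd g)"
      by blast
    then show ?case by (intro exI[of _ "k1 + k2"]) (simp add: algebra_simps)
  qed
  then show ?thesis
    using that by blast
qed

lemma two_valued_map_of_pair:
  fixes f1 f2 :: "'a::topological_space \<Rightarrow> 'b::t1_space"
  assumes f: "continuous_on X f1" "f1 ` X \<subseteq> Y" "continuous_on X f2" "f2 ` X \<subseteq> Y"
    and ne: "\<And>x. x \<in> X \<Longrightarrow> f1 x \<noteq> f2 x"
  shows "two_valued_map X Y (\<lambda>x. {f1 x, f2 x})"
proof -
  have "openin (top_of_set X) {x \<in> X. {f1 x, f2 x} \<subseteq> V}"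
       "openin (top_of_set X) {x \<in> X. {f1 x, f2 x} \<inter> V \<noteq> {}}"
    if V: "openin (top_of_set Y) V" for V
  proof -
    have 1: "openin (top_of_set X) (X \<inter> f1 -` V)"
      using continuous_openin_preimage[OF f(1) _ V] f(2) by blast
    have 2: "openin (top_of_set X) (X \<inter> f2 -` V)"
      using continuous_openin_preimage[OF f(3) _ V] f(4) by blast
    have "{x \<in> X. {f1 x, f2 x} \<subseteq> V} = (X \<inter> f1 -` V) \<inter> (X \<inter> f2 -` V)"
      "{x \<in> X. {f1 x, f2 x} \<inter> V \<noteq> {}} = (X \<inter> f1 -` V) \<union> (X \<inter> f2 -` V)"
      by auto
    then show "openin (top_of_set X) {x \<in> X. {f1 x, f2 x} \<subseteq> V}"
       "openin (top_of_set X) {x \<in> X. {f1 x, f2 x} \<inter> V \<noteq> {}}"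
      using openin_Int[OF 1 2] openin_Un[OF 1 2] by simp_all
  qed
  moreover have "closedin (top_of_set Y) {f1 x, f2 x}" if "x \<in> X" for x
    using f that by (intro closed_subset) auto
  ultimately show ?thesis
    using f ne by (auto simp: two_valued_map_def multimap_continuous_def)
qed

section \<open>Realising the braids\<close>

text \<open>Both sides are homomorphisms on the fibre group, and they agree on \<open>u\<close> and \<open>v\<close>.\<close>

lemma Ab_eq_winding:
  assumes xx: "xx \<in> config2 torus"
    and uv: "free_basis (fibre_group xx) {u, v}"
    and u: "pi1_map torus fst u = e1 (fst xx)"
    and v: "pi1_map torus fst v = e2 (fst xx)"
    and Ab: "Ab \<in> hom (fibre_group xx) Z2" "Ab u = (1, 0)" "Ab v = (0, 1)"
    and w: "w \<in> carrier (fibre_group xx)"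
  shows "pi1_map torus fst w = translation_class (fst xx) (Ab w)"
proof -
  have y: "fst xx \<in> torus"
    using xx by (auto simp: config2_def)
  have "pi1_map torus fst \<in> hom (P2 xx) (pi1 torus (fst xx))"
    unfolding P2_def by (rule pi1_map_hom[OF fst_config2(1) fst_config2(2)])
  then have p: "pi1_map torus fst \<in> hom (fibre_group xx) (pi1 torus (fst xx))"
    using subgroup.subset[OF subgroup_fibre[OF xx]] by (simp add: hom_def fibre_group_def subset_iff Pi_iff)
  have "translation_class (fst xx) \<circ> Ab \<in> hom (fibre_group xx) (pi1 torus (fst xx))"
    by (rule hom_compose[OF Ab(1) translation_class_hom[OF y]])
  moreover have "pi1_map torus fst x = (translation_class (fst xx) \<circ> Ab) x" if "x \<in> {u, v}" for x
    using that u v Ab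
    by (auto simp: e1_def e2_def translation_class_def meridian_eq_translate[abs_def] longitude_eq_translate[abs_def])
  ultimately have "pi1_map torus fst w = (translation_class (fst xx) \<circ> Ab) w"
    using hom_eq_on_free_basis[OF group_fibre_group[OF xx] group_pi1[OF y] p _ uv _ w] by blast
  then show ?thesis
    by simp
qed

theorem theorem7:
  fixes a b c d m n r s :: int
    and xx :: "pt \<times> pt" and z :: pt
    and \<gamma> :: "pt \<times> pt \<Rightarrow> real \<Rightarrow> pt \<times> pt"
    and u v :: "(real \<Rightarrow> pt \<times> pt) set"
    and Ab :: "(real \<Rightarrow> pt \<times> pt) set \<Rightarrow> int \<times> int"
  assumes xx: "xx \<in> config2 torus" and z: "z \<in> torus"
    and \<gamma>: "basepoint_paths (config2 torus) xx \<gamma>"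
    and uv: "free_basis (fibre_group xx) {u, v}"
    and u: "pi1_map torus fst u = e1 (fst xx)"
    and v: "pi1_map torus fst v = e2 (fst xx)"
    and Ab: "Ab \<in> hom (fibre_group xx) Z2" "Ab u = (1, 0)" "Ab v = (0, 1)"
    and cyclic: "\<exists>g. ((\<exists>q. g = (0, q) \<or> g = (1, q)) \<or> (\<exists>p. g = (p, 0) \<or> g = (p, 1))) \<and>
                  {(a - 1, b), (c, d - 1), (m, n)} \<subseteq> generate Z2 {g}"
  shows "\<exists>w \<phi> \<Phi>. w \<in> carrier (fibre_group xx) \<and>
           two_valued_map torus torus \<phi> \<and> split_map torus torus \<phi> \<and> fixed_point_free torus \<phi> \<and>
           is_lift torus torus \<phi> \<Phi> \<and>
           Ab w = (m, n) \<and>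
           pi1_transport (config2 torus) (\<gamma> (\<Phi> z)) (pi1_map (config2 torus) \<Phi> (e1 z))
             = P2_elem xx (w [^]\<^bsub>fibre_group xx\<^esub> r) (a, b) \<and>
           pi1_transport (config2 torus) (\<gamma> (\<Phi> z)) (pi1_map (config2 torus) \<Phi> (e2 z))
             = P2_elem xx (w [^]\<^bsub>fibre_group xx\<^esub> s) (c, d)"
proof -
  obtain g where g: "(\<exists>q. g = (0, q) \<or> g = (1, q)) \<or> (\<exists>p. g = (p, 0) \<or> g = (p, 1))"
    and "(a - 1, b) \<in> generate Z2 {g}" "(c, d - 1) \<in> generate Z2 {g}" "(m, n) \<in> generate Z2 {g}"
    using cyclic by blast
  then obtain k l j where k: "(a - 1, b) = (k * fst g, k * snd g)"
    and l: "(c, d - 1) = (l * fst g, l * snd g)" and j: "(m, n) = (j * fst g, j * snd g)"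
    by (meson generate_Z2_multiple)
  let ?g = "(of_int (fst g), of_int (snd g)) :: real \<times> real"
  obtain \<alpha> :: "real \<times> real" where \<alpha>: "\<And>x. x *\<^sub>R ?g + \<alpha> \<notin> \<int> \<times> \<int>" "\<And>x. x *\<^sub>R ?g + 2 *\<^sub>R \<alpha> \<notin> \<int> \<times> \<int>"
    using line_avoiding_lattice[OF g] by blast
  \<comment> \<open>\<open>f1\<close> is shifted by \<open>2 \<alpha>\<close>, so that both \<open>f2\<close> against the identity and \<open>f1\<close> against \<open>f2\<close>
    differ by \<open>\<alpha>\<close>\<close>
  define f1 where "f1 = torus_affine (translate (2 *\<^sub>R \<alpha>) (1, 1)) (a + r * m) (b + r * n) (c + s * m) (d + s * n)"
  define f2 where "f2 = torus_affine (translate \<alpha> (1, 1)) a b c d"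
  define \<Phi> where "\<Phi> = (\<lambda>x. (f1 x, f2 x))"
  define \<phi> where "\<phi> = (\<lambda>x. {f1 x, f2 x})"
  have m: "m = j * fst g" and n: "n = j * snd g"
    using j by auto
  have one: "(1, 1) \<in> torus"
    by (simp add: torus_def)
  have cont: "continuous_on torus f1" "continuous_on torus f2"
    and into: "f1 ` torus \<subseteq> torus" "f2 ` torus \<subseteq> torus"
    using one by (auto simp: f1_def f2_def continuous_on_torus_affine torus_affine_in_torus translate_in_torus)
  have f12: "translate (x *\<^sub>R (of_int m, of_int n)) (f1 y) \<noteq> f2 y" if y: "y \<in> torus" for x y
    using torus_affine_no_coincidence[OF y, of "a + r * m" a "b + r * n" b "r * j" "fst g" "snd g"
        "c + s * m" c "d + s * n" d "s * j" "2 *\<^sub>R \<alpha>" \<alpha> "x * j"] \<alpha>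
    by (simp add: f1_def f2_def m n scaleR_2 mult.assoc)
  have ne: "f1 y \<noteq> f2 y" if "y \<in> torus" for y
    using f12[OF that, of 0] by (simp add: zero_prod_def[symmetric])
  have f1_fix: "f1 y \<noteq> y" if y: "y \<in> torus" for y
    using torus_affine_no_coincidence[OF y, of "a + r * m" 1 "b + r * n" 0 "k + r * j" "fst g" "snd g"
        "c + s * m" 0 "d + s * n" 1 "l + s * j" "2 *\<^sub>R \<alpha>" 0 0] \<alpha> k l
    by (simp add: f1_def m n torus_affine_id zero_prod_def[symmetric] algebra_simps)
  have f2_fix: "f2 y \<noteq> y" if y: "y \<in> torus" for y
    using torus_affine_no_coincidence[OF y, of a 1 b 0 k "fst g" "snd g" c 0 d 1 l \<alpha> 0 0] \<alpha> k l
    by (simp add: f2_def torus_affine_id zero_prod_def[symmetric])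
  have "continuous_on torus \<Phi>"
    unfolding \<Phi>_def by (intro continuous_intros cont)
  moreover have "\<Phi> ` torus \<subseteq> config2 torus"
    using into ne by (intro image_subsetI) (simp add: \<Phi>_def config2_def image_subset_iff)
  ultimately have \<Phi>: "continuous_on torus \<Phi>" "\<Phi> ` torus \<subseteq> config2 torus"
    by blast+
  have two: "two_valued_map torus torus \<phi>"
    unfolding \<phi>_def by (rule two_valued_map_of_pair[OF cont(1) into(1) cont(2) into(2) ne])
  have split: "split_map torus torus \<phi>"
    unfolding split_map_def \<phi>_def using cont into by blast
  have "y \<notin> \<phi> y" if "y \<in> torus" for y
    using f1_fix[OF that, symmetric] f2_fix[OF that, symmetric] by (simp add: \<phi>_def)
  then have free: "fixed_point_free torus \<phi>"
    unfolding fixed_point_free_def by (rule ballI)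
  have lift: "is_lift torus torus \<phi> \<Phi>"
    using \<Phi> by (simp add: is_lift_def \<phi>_def \<Phi>_def)

  let ?C = "config2 torus"
  have Q: "\<Phi> z \<in> ?C"
    using \<Phi> z by blast
  then have path: "path (\<gamma> (\<Phi> z))" "path_image (\<gamma> (\<Phi> z)) \<subseteq> ?C"
    "pathstart (\<gamma> (\<Phi> z)) = xx" "pathfinish (\<gamma> (\<Phi> z)) = \<Phi> z"
    using \<gamma> by (auto simp: basepoint_paths_def)
  have avoid: "translate (x *\<^sub>R (of_int m, of_int n)) (fst (\<Phi> z)) \<noteq> snd (\<Phi> z)" for x
    using f12[OF z] by (simp add: \<Phi>_def)
  define loop where "loop = (\<lambda>\<tau> t. pair_flow (of_int m, of_int n) (t *\<^sub>R \<tau>) (\<Phi> z))"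
  define w where "w = pi1_transport ?C (\<gamma> (\<Phi> z)) (path_class ?C (loop (1, 0, 0)))"
  have w_fibre: "w \<in> carrier (fibre_group xx)"
    and w_fst: "pi1_map torus fst w = translation_class (fst xx) (m, n)"
    and transported: "pi1_transport ?C (\<gamma> (\<Phi> z)) (path_class ?C (loop (of_int i, of_int i1, of_int i2)))
      = P2_elem xx (w [^]\<^bsub>fibre_group xx\<^esub> i) (i1, i2)" for i i1 i2 :: int
    unfolding w_def loop_def by (rule transport_pair_flow[OF Q path avoid])+
  have Ab_w: "Ab w = (m, n)"
  proof (rule injD[OF inj_translation_class])
    show "fst xx \<in> torus"
      using xx by (auto simp: config2_def)
    show "translation_class (fst xx) (Ab w) = translation_class (fst xx) (m, n)"
      using Ab_eq_winding[OF xx uv u v Ab w_fibre] w_fst by simp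
  qed
  have e: "pi1_map ?C \<Phi> (path_class torus (\<lambda>t. translate (t *\<^sub>R (of_int i, of_int i')) z))
      = path_class ?C (\<lambda>t. \<Phi> (translate (t *\<^sub>R (of_int i, of_int i')) z))" for i i' :: int
    using pi1_map_path_class[OF \<Phi> translation_loop[OF z]] by (simp add: o_def)
  \<comment> \<open>affine maps carry straight loops to straight loops, here to orbits of the flow on pairs\<close>
  have "pi1_map ?C \<Phi> (e1 z) = path_class ?C (loop (of_int r, of_int a, of_int b))"
    using e[of 1 0]
    by (simp add: e1_def meridian_eq_translate[abs_def] loop_def \<Phi>_def pair_flow_def f1_def f2_def
        torus_affine_translate algebra_simps)
  moreover have "pi1_map ?C \<Phi> (e2 z) = path_class ?C (loop (of_int s, of_int c, of_int d))"
    using e[of 0 1]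
    by (simp add: e2_def longitude_eq_translate[abs_def] loop_def \<Phi>_def pair_flow_def f1_def f2_def
        torus_affine_translate algebra_simps)
  ultimately show ?thesis
    using two split free lift w_fibre transported Ab_w by metis
qed

end
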